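(* Let $G=(V,E)$ be a finite simple graph with $V\neq\emptyset$ and let $\mathcal{C}\subseteq V$ be an independent set of $G$. Then $$\operatorname{vol}(\mathbf{M}(G,\mathcal{C}))=\frac{|\Sigma(G,\mathcal{C})|}{|V|!}\operatorname{vol}(\Delta(V)).$$
   Context: Graphs are simple (no loops, no multiple edges) and undirected; $x\sim y$ means $(x,y)\in E$. A set of nodes is independent if it contains no two adjacent nodes. $\Delta(V)=\{p\in\mathbb{R}^V : p_x\ge 0 \text{ for all } x\in V,\ \sum_{x\in V}p_x=1\}$ is the set of probability distributions on $V$. A point $x\in V$ is a mode of $p\in\Delta(V)$ if $p_x\ge p_y$ for all $y\sim x$. The polytope of $\mathcal{C}$-modes in $G$ is $\mathbf{M}(G,\mathcal{C})=\{p\in\Delta(V): \text{every } x\in\mathcal{C}\text{ is a mode of } p\}$. With $N=|V|$, $\Sigma(G,\mathcal{C})$ is the set of all bijections $\sigma:\{1,\dots,N\}\to V$ that satisfy $\sigma^{-1}(x)<\sigma^{-1}(y)$ for all $y\in\mathcal{C}$ and all $x\sim y$. $\operatorname{vol}$ denotes the $(|V|-1)$-dimensional volume in the affine hyperplane $\{p\in\mathbb{R}^V:\sum_{x}p_x=1\}$. *)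

theory Defs
  imports "HOL-Analysis.Analysis"
begin

section \<open>Graphs and modes\<close>

text \<open>The vertex set is a finite type and the edges are given by an adjacency relation.\<close>

definition simple_graph :: "('v::finite \<Rightarrow> 'v \<Rightarrow> bool) \<Rightarrow> bool" where
  "simple_graph adj \<longleftrightarrow> symp adj \<and> irreflp adj"

definition independent_nodes :: "('v::finite \<Rightarrow> 'v \<Rightarrow> bool) \<Rightarrow> 'v set \<Rightarrow> bool" where
  "independent_nodes adj C \<longleftrightarrow> (\<forall>x\<in>C. \<forall>y\<in>C. \<not> adj x y)"

definition prob_simplex :: "(real^'v::finite) set" where
  "prob_simplex = {p. (\<forall>x. 0 \<le> p $ x) \<and> (\<Sum>x\<in>UNIV. p $ x) = 1}"

definition is_mode :: "('v::finite \<Rightarrow> 'v \<Rightarrow> bool) \<Rightarrow> real^'v \<Rightarrow> 'v \<Rightarrow> bool" where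
  "is_mode adj p x \<longleftrightarrow> (\<forall>y. adj y x \<longrightarrow> p $ y \<le> p $ x)"

definition mode_polytope :: "('v::finite \<Rightarrow> 'v \<Rightarrow> bool) \<Rightarrow> 'v set \<Rightarrow> (real^'v) set" where
  "mode_polytope adj C = {p \<in> prob_simplex. \<forall>x\<in>C. is_mode adj p x}"

text \<open>Functions on \<open>{1..N}\<close> are represented extensionally (by \<open>undefined\<close> outside
  \<open>{1..N}\<close>), so that each bijection is counted exactly once.\<close>

definition mode_orderings :: "('v::finite \<Rightarrow> 'v \<Rightarrow> bool) \<Rightarrow> 'v set \<Rightarrow> (nat \<Rightarrow> 'v) set" where
  "mode_orderings adj C =
     {\<sigma> \<in> {1..CARD('v)} \<rightarrow>\<^sub>E UNIV. bij_betw \<sigma> {1..CARD('v)} UNIV \<and>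
        (\<forall>y\<in>C. \<forall>x. adj x y \<longrightarrow>
           inv_into {1..CARD('v)} \<sigma> x < inv_into {1..CARD('v)} \<sigma> y)}"


section \<open>Volume in the hyperplane of vectors with coordinate sum 1\<close>

text \<open>With \<open>d = CARD('v) - 1\<close>, an orthonormal frame of the hyperplane consists of a base point
  and an orthonormal basis \<open>b 0, \<dots>, b (d - 1)\<close> of the direction space. It identifies the
  hyperplane isometrically with \<open>d\<close>-dimensional Euclidean space, here functions on \<open>{..<d}\<close>
  (there is no type of dimension 0, and none for \<open>d\<close> in terms of \<open>'v\<close>), from which Lebesgue
  measure is transported (on Borel sets, which include all polytopes). The result does not depend on the frame
  (\<open>hyperplane_measure_eq\<close> below).\<close>

definition hyperplane_frame :: "real^'v::finite \<Rightarrow> (nat \<Rightarrow> real^'v) \<Rightarrow> bool" where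
  "hyperplane_frame a b \<longleftrightarrow>
     (\<Sum>x\<in>UNIV. a $ x) = 1 \<and>
     (\<forall>i<CARD('v) - 1. (\<Sum>x\<in>UNIV. b i $ x) = 0) \<and>
     (\<forall>i<CARD('v) - 1. \<forall>j<CARD('v) - 1. b i \<bullet> b j = (if i = j then 1 else 0))"

definition frame_measure :: "real^'v::finite \<Rightarrow> (nat \<Rightarrow> real^'v) \<Rightarrow> (real^'v) measure" where
  "frame_measure a b =
     distr (Pi\<^sub>M {..<CARD('v) - 1} (\<lambda>_. lborel)) borel
       (\<lambda>c. a + (\<Sum>i<CARD('v) - 1. c i *\<^sub>R b i))"

definition hyperplane_measure :: "(real^'v::finite) measure" where
  "hyperplane_measure = (THE M. \<exists>a b. hyperplane_frame a b \<and> M = frame_measure a b)"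

definition vol :: "(real^'v::finite) set \<Rightarrow> real" where
  "vol A = measure hyperplane_measure A"


subsection \<open>Existence of frames\<close>

lemma sum_coords_inner: "(\<Sum>x\<in>UNIV. p $ x) = (\<chi> i. 1) \<bullet> (p :: real^'v::finite)"
  by (simp add: inner_vec_def)

lemma ex_hyperplane_frame: "\<exists>(a :: real^'v::finite) b. hyperplane_frame a b"
proof -
  define j :: "real^'v" where "j = (\<chi> i. 1)"
  have j0: "j \<noteq> 0" by (simp add: j_def vec_eq_iff)
  define S where "S = {x. j \<bullet> x = 0}"
  have "subspace S" unfolding S_def by (rule subspace_hyperplane)
  then obtain B where B: "B \<subseteq> S" "pairwise orthogonal B" "\<And>x. x \<in> B \<Longrightarrow> norm x = 1"
    "independent B" "card B = dim S"
    using orthonormal_basis_subspace by metis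
  have card: "card B = CARD('v) - 1"
    using B(5) dim_hyperplane[OF j0] by (simp add: S_def)
  have "finite B" using B(4) by (rule independent_imp_finite)
  then obtain b where b: "bij_betw b {..<CARD('v) - 1} B"
    using ex_bij_betw_nat_finite[of B] card by (auto simp: atLeast0LessThan)
  have bB: "b i \<in> B" if "i < CARD('v) - 1" for i
    using b that by (auto simp: bij_betw_def)
  have inj: "b i = b k \<longleftrightarrow> i = k" if "i < CARD('v) - 1" "k < CARD('v) - 1" for i k
    using b that by (auto simp: bij_betw_def inj_on_def)
  define a :: "real^'v" where "a = axis undefined 1"
  have "(\<Sum>x\<in>UNIV. a $ x) = 1" by (simp add: a_def axis_def)
  moreover have "(\<Sum>x\<in>UNIV. b i $ x) = 0" if "i < CARD('v) - 1" for i
    using bB[OF that] B(1) unfolding sum_coords_inner S_def j_def by auto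
  moreover have "b i \<bullet> b k = (if i = k then 1 else 0)"
    if "i < CARD('v) - 1" "k < CARD('v) - 1" for i k
    using B(2,3) bB[OF that(1)] bB[OF that(2)] inj[OF that]
    by (auto simp: pairwise_def orthogonal_def dot_square_norm)
  ultimately show ?thesis unfolding hyperplane_frame_def by blast
qed


subsection \<open>Independence of the frame\<close>

text \<open>\<open>measure_orthogonal_image\<close> assumes an ordering of the index type, so rotation invariance
  is derived here from uniqueness of translation-invariant measures.\<close>

lemma distr_lborel_isometry:
  fixes T :: "'a::euclidean_space \<Rightarrow> 'a"
  assumes lin: "linear T" and nrm: "\<And>x. norm (T x) = norm x"
  shows "distr lborel borel T = lborel"
proof -
  define M where "M = distr lborel borel T"
  have Tm [measurable]: "T \<in> borel_measurable borel"
    using lin by (intro borel_measurable_continuous_onI linear_continuous_on)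
      (simp add: linear_conv_bounded_linear)
  have setsM [measurable_cong, simp]: "sets M = sets borel" by (simp add: M_def)
  have spaceM [simp]: "space M = UNIV" by (simp add: M_def)
  have "inj T"
    using lin nrm by (metis linear_injective_0 norm_eq_zero)
  then have "surj T" using lin linear_injective_imp_surjective by blast
  define B where "B = ball (0::'a) 1"
  have Bm [measurable]: "B \<in> sets borel" by (simp add: B_def)
  have TB: "emeasure M (ball 0 r) = emeasure lborel (ball (0::'a) r)" for r
  proof -
    have "T -` ball 0 r = ball (0::'a) r" by (auto simp: nrm)
    then show ?thesis by (simp add: M_def emeasure_distr)
  qed
  have trM: "distr M borel ((+) y) = M" for y
  proof -
    obtain z where z: "y = T z" using \<open>surj T\<close> by (metis surjD)
    have "distr M borel ((+) y) = distr lborel borel (\<lambda>x. T (z + x))"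
      unfolding M_def by (subst distr_distr) (auto simp: o_def z linear_add[OF lin])
    also have "\<dots> = distr (distr lborel borel ((+) z)) borel T"
      by (subst distr_distr) (auto simp: o_def)
    also have "\<dots> = M" by (simp add: lborel_distr_plus M_def)
    finally show ?thesis .
  qed
  interpret M: sigma_finite_measure M
  proof (unfold_locales, intro exI conjI)
    show "countable (range (\<lambda>n::nat. ball (0::'a) (real n)))" by simp
    show "range (\<lambda>n::nat. ball (0::'a) (real n)) \<subseteq> sets M" by auto
    show "\<Union> (range (\<lambda>n::nat. ball (0::'a) (real n))) = space M"
      by (auto simp: reals_Archimedean2)
    show "\<forall>a\<in>range (\<lambda>n::nat. ball (0::'a) (real n)). emeasure M a \<noteq> \<infinity>"
      using emeasure_bounded_finite[of "ball (0::'a) _"] by (auto simp: TB less_top)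
  qed
  interpret P: pair_sigma_finite M lborel ..
  have "emeasure M A = emeasure lborel A" if A [measurable]: "A \<in> sets borel" for A
  proof -
    have "emeasure lborel B * emeasure M A
        = (\<integral>\<^sup>+ y. indicator B y * (\<integral>\<^sup>+ x. indicator A x \<partial>M) \<partial>lborel)"
      by (simp add: nn_integral_multc mult.commute)
    also have "\<dots> = (\<integral>\<^sup>+ y. indicator B y * (\<integral>\<^sup>+ x. indicator A (y + x) \<partial>M) \<partial>lborel)"
    proof -
      have "(\<integral>\<^sup>+ x. indicator A x \<partial>M) = (\<integral>\<^sup>+ x. indicator A (y + x) \<partial>M)" for y
        by (subst (1) trM[of y, symmetric], subst nn_integral_distr) auto
      then show ?thesis by simp
    qed
    also have "\<dots> = (\<integral>\<^sup>+ y. (\<integral>\<^sup>+ x. indicator B y * indicator A (y + x) \<partial>M) \<partial>lborel)"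
      by (intro nn_integral_cong nn_integral_cmult[symmetric]) measurable
    also have "\<dots> = (\<integral>\<^sup>+ x. (\<integral>\<^sup>+ y. indicator B y * indicator A (y + x) \<partial>lborel) \<partial>M)"
      by (rule P.Fubini') measurable
    also have "\<dots> = (\<integral>\<^sup>+ x. (\<integral>\<^sup>+ y. indicator B (y - x) * indicator A y \<partial>lborel) \<partial>M)"
    proof (rule nn_integral_cong)
      fix x :: 'a
      show "(\<integral>\<^sup>+ y. indicator B y * indicator A (y + x) \<partial>lborel)
          = (\<integral>\<^sup>+ y. indicator B (y - x) * indicator A y \<partial>lborel)"
        by (subst (2) lborel_distr_plus[of x, symmetric], subst nn_integral_distr)
           (auto simp: add.commute)
    qed
    also have "\<dots> = (\<integral>\<^sup>+ y. (\<integral>\<^sup>+ x. indicator B (y - x) * indicator A y \<partial>M) \<partial>lborel)"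
      by (rule P.Fubini'[symmetric]) measurable
    also have "\<dots> = (\<integral>\<^sup>+ y. (\<integral>\<^sup>+ x. indicator B (y - x) \<partial>M) * indicator A y \<partial>lborel)"
      by (intro nn_integral_cong nn_integral_multc) measurable
    also have "\<dots> = (\<integral>\<^sup>+ y. emeasure M B * indicator A y \<partial>lborel)"
    proof (intro nn_integral_cong arg_cong2[where f = "(*)"] refl)
      fix y :: 'a
      have "(\<integral>\<^sup>+ x. indicator B (y - x) \<partial>M) = (\<integral>\<^sup>+ x. indicator B (- x) \<partial>M)"
        by (subst (1) trM[of y, symmetric], subst nn_integral_distr) auto
      also have "\<dots> = (\<integral>\<^sup>+ x. indicator B x \<partial>M)"
        by (intro nn_integral_cong) (auto simp: B_def split: split_indicator)
      finally show "(\<integral>\<^sup>+ x. indicator B (y - x) \<partial>M) = emeasure M B" by simp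
    qed
    also have "\<dots> = emeasure lborel B * emeasure lborel A"
      by (simp add: nn_integral_cmult TB B_def)
    finally have eq: "emeasure lborel B * emeasure M A = emeasure lborel B * emeasure lborel A" .
    have "emeasure lborel B \<noteq> \<infinity>"
      using emeasure_bounded_finite[of B] by (simp add: B_def less_top)
    moreover have "emeasure lborel B \<noteq> 0"
      using content_ball_pos[of 1 "0::'a"] by (auto simp: B_def measure_def)
    ultimately show ?thesis
      using eq ennreal_mult_cancel_left[of "emeasure lborel B"] by auto
  qed
  then have "M = lborel" by (intro measure_eqI) auto
  then show ?thesis by (simp add: M_def)
qed

lemma distr_PiM_lborel_orthonormal:
  fixes b :: "nat \<Rightarrow> 'a::euclidean_space"
  assumes orth: "\<And>i j. i < DIM('a) \<Longrightarrow> j < DIM('a) \<Longrightarrow> b i \<bullet> b j = (if i = j then 1 else 0)"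
  shows "distr (Pi\<^sub>M {..<DIM('a)} (\<lambda>_. lborel)) borel (\<lambda>c. \<Sum>i<DIM('a). c i *\<^sub>R b i) = lborel"
proof -
  let ?N = "DIM('a)"
  let ?P = "Pi\<^sub>M {..<?N} (\<lambda>_. lborel :: real measure)"
  obtain e :: "nat \<Rightarrow> 'a" where e: "bij_betw e {..<?N} Basis"
    using ex_bij_betw_nat_finite[of "Basis :: 'a set"] by (auto simp: atLeast0LessThan)
  have eB: "e i \<in> Basis" if "i < ?N" for i using e that by (auto simp: bij_betw_def)
  have ee: "e i \<bullet> e j = (if i = j then 1 else 0)" if "i < ?N" "j < ?N" for i j
    using e that eB by (auto simp: bij_betw_def inj_on_def inner_Basis)
  have ball_e: "(\<forall>x\<in>Basis. Q x) \<longleftrightarrow> (\<forall>i<?N. Q (e i))" for Q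
  proof -
    have "(\<forall>x\<in>e ` {..<?N}. Q x) \<longleftrightarrow> (\<forall>i<?N. Q (e i))" by auto
    then show ?thesis unfolding bij_betw_imp_surj_on[OF e] .
  qed
  define E where "E = (\<lambda>c::nat \<Rightarrow> real. \<Sum>i<?N. c i *\<^sub>R e i)"
  define T where "T = (\<lambda>x::'a. \<Sum>i<?N. (x \<bullet> e i) *\<^sub>R b i)"
  have Em [measurable]: "E \<in> borel_measurable ?P" unfolding E_def by measurable
  have Ee: "E c \<bullet> e i = c i" if "i < ?N" for c i
    using that by (simp add: E_def inner_sum_left ee if_distrib cong: if_cong)
  have lb: "distr ?P borel E = lborel"
  proof (rule lborel_eqI[symmetric])
    fix l u :: 'a assume le: "\<And>b. b \<in> Basis \<Longrightarrow> l \<bullet> b \<le> u \<bullet> b"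
    interpret product_sigma_finite "\<lambda>_. lborel :: real measure" ..
    have "E -` box l u \<inter> space ?P = (\<Pi>\<^sub>E i\<in>{..<?N}. {l \<bullet> e i <..< u \<bullet> e i})"
    proof -
      have "E c \<in> box l u \<longleftrightarrow> (\<forall>i<?N. c i \<in> {l \<bullet> e i <..< u \<bullet> e i})" for c
        unfolding mem_box ball_e by (auto simp: Ee)
      then show ?thesis by (auto simp: space_PiM PiE_iff)
    qed
    then have "emeasure (distr ?P borel E) (box l u)
        = (\<Prod>i<?N. emeasure lborel {l \<bullet> e i <..< u \<bullet> e i})"
      by (simp add: emeasure_distr emeasure_PiM)
    also have "\<dots> = (\<Prod>i<?N. ennreal ((u - l) \<bullet> e i))"
      by (intro prod.cong refl) (simp add: le eB inner_diff_left)
    also have "\<dots> = (\<Prod>b\<in>Basis. ennreal ((u - l) \<bullet> b))"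
      using e by (rule prod.reindex_bij_betw)
    also have "\<dots> = ennreal (\<Prod>b\<in>Basis. (u - l) \<bullet> b)"
      by (intro prod_ennreal) (simp add: le inner_diff_left)
    finally show "emeasure (distr ?P borel E) (box l u) = ennreal (\<Prod>b\<in>Basis. (u - l) \<bullet> b)" .
  qed simp
  have lin: "linear T"
    unfolding T_def
    by (intro linearI) (simp_all add: inner_add_left scaleR_add_left sum.distrib scaleR_sum_right)
  have nrm: "norm (T x) = norm x" for x
  proof -
    have "T x \<bullet> T x = (\<Sum>i<?N. (x \<bullet> e i) * (x \<bullet> e i))"
      unfolding T_def
      by (simp add: inner_sum_left inner_sum_right orth if_distrib cong: if_cong)
    also have "\<dots> = (\<Sum>b\<in>Basis. (x \<bullet> b) * (x \<bullet> b))"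
      using e by (rule sum.reindex_bij_betw)
    also have "\<dots> = x \<bullet> x" by (simp add: euclidean_inner[of x x])
    finally show ?thesis by (simp add: norm_eq_sqrt_inner)
  qed
  have Tm: "T \<in> borel_measurable borel"
    using lin by (intro borel_measurable_continuous_onI linear_continuous_on)
      (simp add: linear_conv_bounded_linear)
  have "T (E c) = (\<Sum>i<?N. c i *\<^sub>R b i)" for c
    unfolding T_def by (intro sum.cong refl) (simp add: Ee)
  then have "distr ?P borel (\<lambda>c. \<Sum>i<?N. c i *\<^sub>R b i) = distr (distr ?P borel E) borel T"
    by (subst distr_distr) (auto simp: o_def Tm)
  also have "\<dots> = lborel" by (simp add: lb distr_lborel_isometry[OF lin nrm])
  finally show ?thesis .
qed

text \<open>Cavalieri: the measure of \<open>A\<close> is the Lebesgue measure of the cylinder of height 1 over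
  \<open>A\<close> in the direction of the unit normal.\<close>

lemma emeasure_frame_measure:
  fixes a :: "real^'v::finite"
  assumes fr: "hyperplane_frame a b" and A [measurable]: "A \<in> sets borel"
  defines "u \<equiv> ((\<chi> i. 1 / sqrt CARD('v)) :: real^'v)"
  defines "s \<equiv> (\<lambda>q::real^'v. q \<bullet> u - 1 / sqrt CARD('v))"
  shows "emeasure (frame_measure a b) A
    = emeasure lborel {q. s q \<in> {0..1} \<and> q - s q *\<^sub>R u \<in> A}"
proof -
  define d where "d = CARD('v) - 1"
  have N: "CARD('v) = Suc d" by (simp add: d_def)
  have DIM: "DIM(real^'v) = Suc d" using N by simp
  have uin: "p \<bullet> u = (\<Sum>x\<in>UNIV. p $ x) / sqrt CARD('v)" for p
    by (simp add: u_def inner_vec_def sum_divide_distrib)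
  have uu: "u \<bullet> u = 1" by (simp add: u_def inner_vec_def)
  have au: "a \<bullet> u = 1 / sqrt CARD('v)" using fr by (simp add: uin hyperplane_frame_def)
  have bu: "b i \<bullet> u = 0" if "i < d" for i
    using fr that by (simp add: uin hyperplane_frame_def d_def)
  have ub: "u \<bullet> b i = 0" if "i < d" for i
    using bu[OF that] by (simp add: inner_commute)
  have bb: "b i \<bullet> b j = (if i = j then 1 else 0)" if "i < d" "j < d" for i j
    using fr that unfolding hyperplane_frame_def d_def by blast
  define b' where "b' = b(d := u)"
  have orth: "b' i \<bullet> b' j = (if i = j then 1 else 0)" if "i < Suc d" "j < Suc d" for i j
  proof -
    have "i < d \<or> i = d" "j < d \<or> j = d" using that by auto
    then show ?thesis
      using that by (auto simp: b'_def bb bu ub uu)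
  qed
  define \<phi> where "\<phi> = (\<lambda>c::nat \<Rightarrow> real. a + (\<Sum>i<d. c i *\<^sub>R b i))"
  let ?P = "\<lambda>n. Pi\<^sub>M {..<n::nat} (\<lambda>_. lborel :: real measure)"
  define Z where "Z = {q. s q \<in> {0..1} \<and> q - s q *\<^sub>R u \<in> A}"
  have sm [measurable]: "s \<in> borel_measurable borel" unfolding s_def by measurable
  have Zm [measurable]: "Z \<in> sets borel" unfolding Z_def by measurable
  have phm [measurable]: "\<phi> \<in> borel_measurable (?P d)" unfolding \<phi>_def by measurable
  define \<Psi> where "\<Psi> = (\<lambda>c::nat \<Rightarrow> real. a + (\<Sum>i<Suc d. c i *\<^sub>R b' i))"
  have psm [measurable]: "\<Psi> \<in> borel_measurable (?P (Suc d))" unfolding \<Psi>_def by measurable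
  have "distr (?P (Suc d)) borel \<Psi>
      = distr (distr (?P (Suc d)) borel (\<lambda>c. \<Sum>i<Suc d. c i *\<^sub>R b' i)) borel ((+) a)"
    unfolding \<Psi>_def by (subst distr_distr) (auto simp: o_def)
  also have "\<dots> = lborel"
    using distr_PiM_lborel_orthonormal[of b'] orth
    unfolding DIM by (simp add: lborel_distr_plus)
  finally have lb: "distr (?P (Suc d)) borel \<Psi> = lborel" .
  have Psi: "\<Psi> (c(d := t)) = \<phi> c + t *\<^sub>R u" for c t
    by (simp add: \<Psi>_def \<phi>_def b'_def)
  have sphi: "s (\<phi> c + t *\<^sub>R u) = t" for c t
    by (simp add: s_def \<phi>_def inner_add_left inner_sum_left bu uu au)
  have Zind: "indicator Z (\<Psi> (c(d := t))) = (indicator {0..1} t * indicator A (\<phi> c) :: ennreal)"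
    for c t
    unfolding Psi by (auto simp: Z_def sphi split: split_indicator)
  interpret product_sigma_finite "\<lambda>_::nat. lborel :: real measure" ..
  have "emeasure lborel Z = (\<integral>\<^sup>+ q. indicator Z q \<partial>distr (?P (Suc d)) borel \<Psi>)"
    by (simp add: lb)
  also have "\<dots> = (\<integral>\<^sup>+ c. indicator Z (\<Psi> c) \<partial>?P (Suc d))"
    by (rule nn_integral_distr) auto
  also have "\<dots> = (\<integral>\<^sup>+ c. indicator Z (\<Psi> c) \<partial>Pi\<^sub>M (insert d {..<d}) (\<lambda>_. lborel))"
    by (simp add: lessThan_Suc)
  also have "\<dots> = (\<integral>\<^sup>+ c. (\<integral>\<^sup>+ t. indicator Z (\<Psi> (c(d := t))) \<partial>lborel) \<partial>?P d)"
    by (rule product_nn_integral_insert) (use psm in \<open>auto simp flip: lessThan_Suc\<close>)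
  also have "\<dots> = (\<integral>\<^sup>+ c. indicator A (\<phi> c) \<partial>?P d)"
    unfolding Zind by (intro nn_integral_cong) (simp add: nn_integral_multc)
  also have "\<dots> = (\<integral>\<^sup>+ q. indicator A q \<partial>distr (?P d) borel \<phi>)"
    by (rule nn_integral_distr[symmetric]) auto
  also have "\<dots> = emeasure (distr (?P d) borel \<phi>) A"
    by simp
  finally show ?thesis unfolding Z_def frame_measure_def \<phi>_def d_def by simp
qed

lemma frame_measure_unique:
  assumes "hyperplane_frame a b" "hyperplane_frame a' b'"
  shows "frame_measure a b = frame_measure a' b'"
  by (rule measure_eqI)
     (auto simp: emeasure_frame_measure[OF assms(1)] emeasure_frame_measure[OF assms(2)]
        frame_measure_def[THEN arg_cong[of _ _ sets]])

lemma hyperplane_measure_eq: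
  assumes "hyperplane_frame a b"
  shows "hyperplane_measure = frame_measure a b"
  unfolding hyperplane_measure_def
  using assms frame_measure_unique by (intro the_equality) blast+

end

theory Submission
  imports Defs
begin

text \<open>The vectors without ties among their coordinates split into the cells on which the coordinates
  are strictly increasing along a fixed ordering of the vertices. Permuting coordinates preserves the
  volume, so all these cells have the same volume inside the simplex. Up to ties, which form a null
  set, the simplex is the union of all cells and the mode polytope is the union of those cells whose
  ordering belongs to \<open>\<Sigma>(G, C)\<close>.\<close>

subsection \<open>Symmetries and null sets of the hyperplane measure\<close>

text \<open>\<open>hyperplane_measure\<close> is a definite description, so its sigma-algebra is
  read off from an arbitrary frame.\<close>

lemma sets_hyperplane_measure [simp, measurable_cong]: "sets (hyperplane_measure :: (real^'v::finite) measure) = sets borel"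
proof -
  obtain a :: "real^'v" and b where "hyperplane_frame a b"
    using ex_hyperplane_frame by blast
  then show ?thesis
    by (simp add: hyperplane_measure_eq frame_measure_def)
qed

lemma space_hyperplane_measure [simp]: "space (hyperplane_measure :: (real^'v::finite) measure) = UNIV"
  using sets_eq_imp_space_eq[OF sets_hyperplane_measure] by simp

definition permute_coords :: "('v \<Rightarrow> 'v) \<Rightarrow> real^'v \<Rightarrow> real^'v::finite" where
  "permute_coords \<pi> p = (\<chi> x. p $ \<pi> x)"

lemma permute_coords_nth [simp]: "permute_coords \<pi> p $ x = p $ \<pi> x"
  by (simp add: permute_coords_def)

lemma linear_permute_coords: "linear (permute_coords \<pi>)"
  by (intro linearI) (simp_all add: vec_eq_iff)

lemma sum_permute_coords:
  assumes "bij \<pi>" shows "(\<Sum>x\<in>UNIV. p $ \<pi> x) = (\<Sum>x\<in>UNIV. p $ x)"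
  using sum.reindex_bij_betw[OF assms] .

lemma inner_permute_coords:
  assumes "bij \<pi>" shows "permute_coords \<pi> p \<bullet> permute_coords \<pi> q = p \<bullet> q"
  using sum.reindex_bij_betw[OF assms, of "\<lambda>x. p $ x \<bullet> q $ x"] by (simp add: inner_vec_def)

lemma measurable_permute_coords [measurable]: "permute_coords \<pi> \<in> borel_measurable borel"
  using linear_permute_coords
  by (intro borel_measurable_continuous_onI linear_continuous_on)
    (simp add: linear_conv_bounded_linear)

lemma hyperplane_frame_permute_coords:
  assumes "bij \<pi>" "hyperplane_frame a b"
  shows "hyperplane_frame (permute_coords \<pi> a) (\<lambda>i. permute_coords \<pi> (b i))"
  using assms(2) unfolding hyperplane_frame_def
  by (simp add: inner_permute_coords[OF assms(1)] sum_permute_coords[OF assms(1)])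

text \<open>A coordinate permutation preserves inner products and coordinate sums, hence maps frames
  to frames, and the measure does not depend on the frame.\<close>

lemma distr_hyperplane_measure_permute_coords:
  fixes \<pi> :: "'v::finite \<Rightarrow> 'v"
  assumes "bij \<pi>"
  shows "distr hyperplane_measure borel (permute_coords \<pi>) = hyperplane_measure"
proof -
  obtain a :: "real^'v" and b where ab: "hyperplane_frame a b"
    using ex_hyperplane_frame by blast
  have "distr (frame_measure a b) borel (permute_coords \<pi>)
      = frame_measure (permute_coords \<pi> a) (\<lambda>i. permute_coords \<pi> (b i))"
    unfolding frame_measure_def
    by (subst distr_distr)
      (auto simp: o_def linear_add[OF linear_permute_coords] linear_sum[OF linear_permute_coords]
        linear_cmul[OF linear_permute_coords])
  then show ?thesis
    using hyperplane_measure_eq[OF ab]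
      hyperplane_measure_eq[OF hyperplane_frame_permute_coords[OF assms ab]] by simp
qed

lemma emeasure_permute_coords_vimage:
  assumes "bij \<pi>" "A \<in> sets borel"
  shows "emeasure hyperplane_measure (permute_coords \<pi> -` A) = emeasure hyperplane_measure A"
  using assms emeasure_distr[of "permute_coords \<pi>" hyperplane_measure borel A]
  by (simp add: distr_hyperplane_measure_permute_coords)

text \<open>The tie set is a linear hyperplane containing the all-ones vector, which is the normal
  direction of the simplex. The cylinder of height 1 over it therefore stays inside it and is
  Lebesgue null.\<close>

lemma null_sets_tie:
  fixes x y :: "'v::finite"
  assumes "x \<noteq> y"
  shows "{p. p $ x = p $ y} \<in> null_sets (hyperplane_measure :: (real^'v) measure)"
proof -
  obtain a :: "real^'v" and b where ab: "hyperplane_frame a b"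
    using ex_hyperplane_frame by blast
  let ?T = "{p :: real^'v. p $ x = p $ y}"
  define v :: "real^'v" where "v = axis x 1 - axis y 1"
  have "v $ x \<noteq> 0" using assms by (simp add: v_def axis_def)
  then have "v \<noteq> 0" by auto
  have T: "?T = {p. v \<bullet> p = 0}"
    by (simp add: v_def inner_diff_left inner_axis')
  have Tm: "?T \<in> sets borel" unfolding T by measurable
  have "negligible ?T"
    unfolding T using \<open>v \<noteq> 0\<close> by (intro negligible_hyperplane) simp
  then have null: "emeasure lborel ?T = 0"
    using Tm by (simp add: negligible_iff_emeasure0)
  \<comment> \<open>Subtracting a multiple of the constant vector changes both coordinates equally,
    so every \<open>q\<close> in the cylinder already has a tie.\<close>
  have "emeasure hyperplane_measure ?T \<le> emeasure lborel ?T"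
    unfolding hyperplane_measure_eq[OF ab] emeasure_frame_measure[OF ab Tm]
    using Tm by (intro emeasure_mono) auto
  then show ?thesis
    using null Tm by (simp add: null_setsI)
qed

definition ties :: "(real^'v::finite) set" where
  "ties = {p. \<not> inj (($) p)}"

lemma null_sets_ties: "ties \<in> null_sets (hyperplane_measure :: (real^'v::finite) measure)"
proof -
  have "ties = (\<Union>(x, y)\<in>{(x, y). x \<noteq> y}. {p :: real^'v. p $ x = p $ y})"
    by (auto simp: ties_def inj_def)
  also have "\<dots> \<in> null_sets hyperplane_measure"
    by (intro null_sets_UN') (auto intro: countable_finite null_sets_tie)
  finally show ?thesis .
qed

subsection \<open>Cells of the simplex\<close>

text \<open>With weak inequalities these would be the maximal simplices of the barycentric
  subdivision of \<open>prob_simplex\<close>; strictness makes them disjoint and removes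
  ties.\<close>

definition order_cell :: "(nat \<Rightarrow> 'v) \<Rightarrow> (real^'v::finite) set" where
  "order_cell \<sigma> = {p \<in> prob_simplex. \<forall>i\<in>{1..CARD('v)}. \<forall>j\<in>{1..CARD('v)}.
     i < j \<longrightarrow> p $ \<sigma> i < p $ \<sigma> j}"

text \<open>The case \<open>C = {}\<close> of \<open>mode_orderings\<close>, with the same
  extensional encoding.\<close>

definition orderings :: "(nat \<Rightarrow> 'v::finite) set" where
  "orderings = {\<sigma> \<in> {1..CARD('v)} \<rightarrow>\<^sub>E UNIV. bij_betw \<sigma> {1..CARD('v)} UNIV}"

lemma closed_prob_simplex: "closed (prob_simplex :: (real^'v::finite) set)"
  unfolding prob_simplex_def
  by (intro closed_Collect_conj closed_Collect_all closed_Collect_le closed_Collect_eq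
      continuous_intros)

lemma borel_prob_simplex [measurable]: "prob_simplex \<in> sets borel"
  using closed_prob_simplex by (rule borel_closed)

lemma borel_mode_polytope [measurable]: "mode_polytope adj C \<in> sets borel"
proof -
  have "mode_polytope adj C = {p \<in> space borel. p \<in> prob_simplex \<and>
      (\<forall>x. \<forall>y. x \<in> C \<and> adj y x \<longrightarrow> p $ y \<le> p $ x)}"
    by (auto simp: mode_polytope_def is_mode_def)
  also have "\<dots> \<in> sets borel" by measurable
  finally show ?thesis .
qed

lemma borel_order_cell [measurable]: "order_cell \<sigma> \<in> sets borel"
proof -
  have "order_cell \<sigma> = {p \<in> space borel. p \<in> prob_simplex \<and>
      (\<forall>i\<in>{1..CARD('a)}. \<forall>j\<in>{1..CARD('a)}. i < j \<longrightarrow> p $ \<sigma> i < p $ \<sigma> j)}"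
    by (auto simp: order_cell_def)
  also have "\<dots> \<in> sets borel" by measurable
  finally show ?thesis .
qed

lemma emeasure_order_cell_eq:
  fixes \<sigma> \<tau> :: "nat \<Rightarrow> 'v::finite"
  assumes "\<sigma> \<in> orderings" "\<tau> \<in> orderings"
  shows "emeasure hyperplane_measure (order_cell \<sigma>) = emeasure hyperplane_measure (order_cell \<tau>)"
proof -
  let ?I = "{1..CARD('v)}"
  have s: "bij_betw \<sigma> ?I UNIV" and t: "bij_betw \<tau> ?I UNIV"
    using assms by (auto simp: orderings_def)
  \<comment> \<open>The relabelling that sends \<open>\<sigma> i\<close> to \<open>\<tau> i\<close>;
    pulling the cell of \<open>\<sigma>\<close> back along it gives the cell of
    \<open>\<tau>\<close>.\<close>
  define \<pi> where "\<pi> = \<tau> \<circ> inv_into ?I \<sigma>"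
  have \<pi>: "bij \<pi>"
    unfolding \<pi>_def using bij_betw_trans[OF bij_betw_inv_into[OF s] t] .
  have pi_s: "\<pi> (\<sigma> i) = \<tau> i" if "i \<in> ?I" for i
    using s that by (simp add: \<pi>_def bij_betw_inv_into_left)
  have "(\<forall>x. 0 \<le> p $ \<pi> x) \<longleftrightarrow> (\<forall>x. 0 \<le> p $ x)" for p :: "real^'v"
    using \<pi> by (metis bij_pointE)
  then have "permute_coords \<pi> p \<in> prob_simplex \<longleftrightarrow> p \<in> prob_simplex" for p
    using sum_permute_coords[OF \<pi>, of p] by (simp add: prob_simplex_def)
  then have "permute_coords \<pi> -` order_cell \<sigma> = order_cell \<tau>"
    by (auto simp: order_cell_def pi_s)
  then show ?thesis
    using emeasure_permute_coords_vimage[OF \<pi> borel_order_cell[of \<sigma>]] by simp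
qed

section \<open>Ranks and comparisons of coordinates within one cell\<close>

context
  fixes \<sigma> :: "nat \<Rightarrow> 'v::finite" and p :: "real^'v"
  assumes \<sigma>: "\<sigma> \<in> orderings" and p: "p \<in> order_cell \<sigma>"
begin

lemma order_cell_le_iff:
  assumes "i \<in> {1..CARD('v)}" "j \<in> {1..CARD('v)}"
  shows "p $ \<sigma> i \<le> p $ \<sigma> j \<longleftrightarrow> i \<le> j"
proof (cases i j rule: linorder_cases)
  case less
  then have "p $ \<sigma> i < p $ \<sigma> j" using p assms by (simp add: order_cell_def)
  with less show ?thesis by simp
next
  case greater
  then have "p $ \<sigma> j < p $ \<sigma> i" using p assms by (simp add: order_cell_def)
  with greater show ?thesis by simp
qed simp

text \<open>The position of a vertex in \<open>\<sigma>\<close> can be recovered from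
  \<open>p\<close> alone, which is what makes different cells disjoint.\<close>

lemma order_cell_rank:
  assumes "i \<in> {1..CARD('v)}"
  shows "card {y. p $ y \<le> p $ \<sigma> i} = i"
proof -
  have bij: "bij_betw \<sigma> {1..CARD('v)} UNIV" using \<sigma> by (simp add: orderings_def)
  have "{y. p $ y \<le> p $ \<sigma> i} = {y \<in> \<sigma> ` {1..CARD('v)}. p $ y \<le> p $ \<sigma> i}"
    unfolding bij_betw_imp_surj_on[OF bij] by simp
  also have "\<dots> = \<sigma> ` {j \<in> {1..CARD('v)}. p $ \<sigma> j \<le> p $ \<sigma> i}"
    by auto
  also have "{j \<in> {1..CARD('v)}. p $ \<sigma> j \<le> p $ \<sigma> i} = {j \<in> {1..CARD('v)}. j \<le> i}"
    using order_cell_le_iff[OF _ assms] by (intro Collect_cong conj_cong refl)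
  also have "\<dots> = {1..i}"
    using assms by auto
  also have "card (\<sigma> ` {1..i}) = i"
    using assms by (subst card_image) (auto intro: inj_on_subset[OF bij_betw_imp_inj_on[OF bij]])
  finally show ?thesis .
qed

text \<open>Translates comparisons of coordinates into comparisons of positions, the language of
  \<open>mode_orderings\<close>.\<close>

lemma order_cell_le_iff_inv:
  "p $ x \<le> p $ y \<longleftrightarrow> inv_into {1..CARD('v)} \<sigma> x \<le> inv_into {1..CARD('v)} \<sigma> y"
proof -
  have surj: "\<sigma> ` {1..CARD('v)} = UNIV"
    using \<sigma> by (auto simp: orderings_def bij_betw_def)
  have inv: "inv_into {1..CARD('v)} \<sigma> z \<in> {1..CARD('v)}"
    "\<sigma> (inv_into {1..CARD('v)} \<sigma> z) = z" for z
    using inv_into_into[of z \<sigma> "{1..CARD('v)}"] f_inv_into_f[of z \<sigma> "{1..CARD('v)}"]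
    unfolding surj by auto
  show ?thesis
    using order_cell_le_iff[OF inv(1)[of x] inv(1)[of y]] unfolding inv(2) .
qed

lemma order_cell_no_ties: "p \<notin> ties"
proof -
  have "inj (inv_into {1..CARD('v)} \<sigma>)"
    using \<sigma> by (auto simp: orderings_def bij_betw_def intro: inj_on_inv_into)
  then have "inj (($) p)"
    \<comment> \<open>Equality of coordinates is split into two inequalities, so that it becomes
      equality of positions.\<close>
    unfolding inj_def order_eq_iff[of "p $ _"] order_cell_le_iff_inv by (simp flip: order_eq_iff)
  then show ?thesis by (simp add: ties_def)
qed

end

lemma disjoint_order_cells: "disjoint_family_on order_cell orderings"
  unfolding disjoint_family_on_def
proof (intro ballI impI, rule ccontr)
  fix \<sigma> \<tau> :: "nat \<Rightarrow> 'a"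
  assume s: "\<sigma> \<in> orderings" and t: "\<tau> \<in> orderings" and "\<sigma> \<noteq> \<tau>"
    and "order_cell \<sigma> \<inter> order_cell \<tau> \<noteq> {}"
  then obtain p where ps: "p \<in> order_cell \<sigma>" and pt: "p \<in> order_cell \<tau>" by blast
  have "\<sigma> i = \<tau> i" if i: "i \<in> {1..CARD('a)}" for i
  proof -
    have surj: "\<tau> ` {1..CARD('a)} = UNIV"
      using t by (auto simp: orderings_def bij_betw_def)
    then obtain j where j: "j \<in> {1..CARD('a)}" "\<sigma> i = \<tau> j" by blast
    \<comment> \<open>Both indices are the rank in \<open>p\<close> of the same vertex.\<close>
    have "i = j"
      using order_cell_rank[OF s ps i] order_cell_rank[OF t pt j(1)] j(2) by simp
    then show ?thesis using j by simp
  qed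
  then have "\<sigma> = \<tau>"
    \<comment> \<open>Outside the index range both functions are \<open>undefined\<close>.\<close>
    using s t by (intro PiE_ext[of _ "{1..CARD('a)}" "\<lambda>_. UNIV"]) (auto simp: orderings_def)
  with \<open>\<sigma> \<noteq> \<tau>\<close> show False by contradiction
qed

text \<open>Without ties, ranking the vertices by their coordinates is a bijection onto the index
  range; its inverse is the required ordering.\<close>

lemma ex_order_cell:
  fixes p :: "real^'v::finite"
  assumes "p \<in> prob_simplex" "p \<notin> ties"
  obtains \<sigma> where "\<sigma> \<in> orderings" "p \<in> order_cell \<sigma>"
proof -
  let ?I = "{1..CARD('v)}"
  define r where "r x = card {y. p $ y \<le> p $ x}" for x
  have mono: "r x < r y" if "p $ x < p $ y" for x y
  proof -
    have "y \<notin> {z. p $ z \<le> p $ x}" "y \<in> {z. p $ z \<le> p $ y}"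
      "{z. p $ z \<le> p $ x} \<subseteq> {z. p $ z \<le> p $ y}"
      using that by auto
    then show ?thesis unfolding r_def by (intro psubset_card_mono[OF finite]) blast
  qed
  have inj: "inj r"
  proof (rule injI)
    fix x y assume "r x = r y"
    then have "p $ x = p $ y" using mono[of x y] mono[of y x] by (metis less_irrefl linorder_cases)
    then show "x = y" using assms(2) by (auto simp: ties_def dest: injD)
  qed
  have sub: "range r \<subseteq> ?I"
  proof clarify
    fix x
    \<comment> \<open>Each vertex is counted in its own rank, so ranks start at 1.\<close>
    have "{x} \<subseteq> {y. p $ y \<le> p $ x}" by simp
    then have "card {x} \<le> r x" unfolding r_def by (intro card_mono) auto
    moreover have "r x \<le> CARD('v)" unfolding r_def by (intro card_mono) auto
    ultimately show "r x \<in> ?I" by simp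
  qed
  have "range r = ?I"
    using sub inj by (intro card_subset_eq) (auto simp: card_image)
  with inj have bij: "bij_betw r UNIV ?I" by (simp add: bij_betw_def)
  define \<sigma> where "\<sigma> = restrict (inv_into UNIV r) ?I"
  have "bij_betw \<sigma> ?I UNIV"
    using bij_betw_inv_into[OF bij] bij_betw_cong[of ?I \<sigma> "inv_into UNIV r"]
    by (simp add: \<sigma>_def)
  then have "\<sigma> \<in> orderings" by (simp add: orderings_def \<sigma>_def)
  moreover have "p $ \<sigma> i < p $ \<sigma> j" if "i \<in> ?I" "j \<in> ?I" "i < j" for i j
  proof -
    have r\<sigma>: "r (\<sigma> k) = k" if "k \<in> ?I" for k
      using bij_betw_inv_into_right[OF bij that] that by (simp add: \<sigma>_def)
    then have "r (\<sigma> i) < r (\<sigma> j)" using that by simp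
    then show ?thesis using mono[of "\<sigma> j" "\<sigma> i"] by (metis linorder_cases order_less_asym r_def)
  qed
  ultimately show ?thesis using assms(1) that by (simp add: order_cell_def)
qed

section \<open>Counting orderings and adding up cell volumes\<close>

lemma finite_orderings: "finite (orderings :: (nat \<Rightarrow> 'v::finite) set)"
proof (rule finite_subset)
  show "orderings \<subseteq> {1..CARD('v)} \<rightarrow>\<^sub>E (UNIV :: 'v set)" by (auto simp: orderings_def)
qed (auto intro: finite_PiE)

lemma card_orderings: "card (orderings :: (nat \<Rightarrow> 'v::finite) set) = fact CARD('v)"
proof -
  \<comment> \<open>Domain and codomain have equal cardinality, so bijections can be counted as
    injections, by a falling factorial.\<close>
  have "bij_betw f {1..CARD('v)} UNIV \<longleftrightarrow> inj_on f {1..CARD('v)}" for f :: "nat \<Rightarrow> 'v"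
    unfolding bij_betw_def using card_subset_eq[of UNIV "f ` {1..CARD('v)}"]
    by (auto simp: card_image)
  then have "orderings = {f \<in> {1..CARD('v)} \<rightarrow>\<^sub>E (UNIV :: 'v set). inj_on f {1..CARD('v)}}"
    by (simp add: orderings_def)
  then show ?thesis
    using card_inj_on_subset_funcset[of "{1..CARD('v)}" "UNIV :: 'v set" "{1..CARD('v)}"]
    by (simp add: fact_prod_rev)
qed

text \<open>Serves both the simplex and the mode polytope: ties are null, the cells are disjoint,
  and each has the volume of the reference cell of \<open>\<sigma>\<close>.\<close>

lemma vol_union_order_cells:
  fixes S :: "(nat \<Rightarrow> 'v::finite) set" and \<sigma> :: "nat \<Rightarrow> 'v"
  assumes "S \<subseteq> orderings" "\<sigma> \<in> orderings" "A \<in> sets borel" "A - ties = \<Union> (order_cell ` S)"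
  shows "vol A = card S * vol (order_cell \<sigma>)"
proof -
  have "emeasure hyperplane_measure A = emeasure hyperplane_measure (\<Union> (order_cell ` S))"
    using emeasure_Diff_null_set[OF null_sets_ties, of A] assms by simp
  also have "\<dots> = (\<Sum>\<tau>\<in>S. emeasure hyperplane_measure (order_cell \<tau>))"
    using assms finite_orderings disjoint_order_cells
    by (intro sum_emeasure[symmetric]) (auto intro: finite_subset disjoint_family_on_mono)
  also have "\<dots> = (\<Sum>\<tau>\<in>S. emeasure hyperplane_measure (order_cell \<sigma>))"
    using assms(1) by (intro sum.cong refl emeasure_order_cell_eq[OF _ assms(2)]) blast
  finally show ?thesis by (simp add: vol_def measure_def enn2real_mult)
qed

lemma prob_simplex_eq_union_order_cells:
  "prob_simplex - ties = \<Union> (order_cell ` orderings)"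
proof (intro equalityI subsetI)
  fix p :: "real^'a"
  assume "p \<in> prob_simplex - ties"
  then show "p \<in> \<Union> (order_cell ` orderings)"
    using ex_order_cell[of p] by blast
next
  fix p :: "real^'a"
  assume "p \<in> \<Union> (order_cell ` orderings)"
  then obtain \<sigma> where "\<sigma> \<in> orderings" "p \<in> order_cell \<sigma>" by blast
  then show "p \<in> prob_simplex - ties"
    using order_cell_no_ties[of \<sigma> p] by (simp add: order_cell_def)
qed

text \<open>All points of a cell order their coordinates alike, so a cell lies either inside the
  polytope or outside it, as decided by \<open>\<sigma>\<close>.\<close>

lemma mode_polytope_eq_union_order_cells:
  fixes adj :: "'v::finite \<Rightarrow> 'v \<Rightarrow> bool"
  assumes "irreflp adj"
  shows "mode_polytope adj C - ties = \<Union> (order_cell ` mode_orderings adj C)"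
proof -
  have "p \<in> mode_polytope adj C \<longleftrightarrow> \<sigma> \<in> mode_orderings adj C"
    if s: "\<sigma> \<in> orderings" and p: "p \<in> order_cell \<sigma>" for \<sigma> and p :: "real^'v"
  proof -
    let ?r = "inv_into {1..CARD('v)} \<sigma>"
    have "inj ?r"
      using s by (auto simp: orderings_def bij_betw_def intro: inj_on_inv_into)
    then have "p $ x \<le> p $ y \<longleftrightarrow> ?r x < ?r y" if "adj x y" for x y
    proof -
      \<comment> \<open>Adjacent vertices are distinct and so have distinct positions; this turns
        the weak mode inequality into the strict one of \<open>mode_orderings\<close>.\<close>
      have "x \<noteq> y" using assms that by (auto dest: irreflpD)
      then have "?r x \<noteq> ?r y" using \<open>inj ?r\<close> by (blast dest: injD)
      then show ?thesis unfolding order_cell_le_iff_inv[OF s p] by linarith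
    qed
    moreover have "p \<in> prob_simplex" using p by (simp add: order_cell_def)
    ultimately show ?thesis
      using s unfolding mode_polytope_def mode_orderings_def is_mode_def orderings_def by blast
  qed
  moreover have "mode_orderings adj C \<subseteq> orderings"
    by (auto simp: mode_orderings_def orderings_def)
  moreover have "mode_polytope adj C - ties
      = mode_polytope adj C \<inter> \<Union> (order_cell ` orderings)"
    unfolding prob_simplex_eq_union_order_cells[symmetric] mode_polytope_def by blast
  ultimately show ?thesis by blast
qed

theorem corollary2:
  fixes adj :: "'v::finite \<Rightarrow> 'v \<Rightarrow> bool" and C :: "'v set"
  assumes "simple_graph adj"
    and "independent_nodes adj C"
  shows "vol (mode_polytope adj C)
       = real (card (mode_orderings adj C)) / fact CARD('v) * vol (prob_simplex :: (real^'v) set)"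
proof -
  \<comment> \<open>A factorial is nonzero, so some ordering exists. Its cell is the common unit of
    volume, eliminated at the end.\<close>
  have "(orderings :: (nat \<Rightarrow> 'v) set) \<noteq> {}"
    using card_orderings[where 'v='v] by auto
  then obtain \<sigma> :: "nat \<Rightarrow> 'v" where \<sigma>: "\<sigma> \<in> orderings" by blast
  have "irreflp adj" using assms(1) by (simp add: simple_graph_def)
  then have "vol (mode_polytope adj C)
      = card (mode_orderings adj C) * vol (order_cell \<sigma>)"
    by (intro vol_union_order_cells \<sigma> borel_mode_polytope mode_polytope_eq_union_order_cells)
      (auto simp: mode_orderings_def orderings_def)
  moreover have "vol (prob_simplex :: (real^'v) set) = fact CARD('v) * vol (order_cell \<sigma>)"
    using vol_union_order_cells[OF order_refl \<sigma> borel_prob_simplex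
        prob_simplex_eq_union_order_cells] by (simp add: card_orderings)
  ultimately show ?thesis by simp
qed

end
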